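(* Let $X$ be a set of cardinality $n$ with $1\leq n\leq 3$. Then the free commutative quandle generated by $X$ is isomorphic to the free medial commutative quandle $\mathrm{FMC}(X)\cong(\mathbb{D}^{n-1})_{\mathrm{mid}}$ generated by $X$, where $\mathbb{D}=\mathbb{Z}[1/2]$.
   Context: A magma $(X,\ast)$ is a set with a binary operation; homomorphisms are maps preserving the operation. For $x\in X$, let $R_x\colon y\mapsto y\ast x$. A rack is a magma in which every $R_x$ is an automorphism of the magma. A quandle is a rack with $x\ast x=x$ for all $x$. A magma is medial if $(a\ast b)\ast(c\ast d)=(a\ast c)\ast(b\ast d)$ for all $a,b,c,d$, and commutative if $x\ast y=y\ast x$ for all $x,y$. For a $\mathbb{D}$-module $M$, the midpoint quandle $M_{\mathrm{mid}}$ is the set $M$ with $x\ast y:=\frac12(x+y)$. The free commutative (resp. medial commutative) quandle generated by a set $X$ is a commutative (resp. medial commutative) quandle $F$ with an injective map $\iota\colon X\to F$ such that for every commutative (resp. medial commutative) quandle $Q$ and every function $f\colon X\to Q$ there is a unique quandle homomorphism $\tilde f\colon F\to Q$ with $\tilde f\circ\iota=f$. The free medial commutative quandle generated by $X$ is denoted $\mathrm{FMC}(X)$. *)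

theory Defs
  imports Complex_Main "HOL-Library.FuncSet" "HOL-Algebra.Module"
begin

section \<open>Magmas, racks and quandles\<close>

record 'a magma = "'a partial_object" +
  star :: "'a \<Rightarrow> 'a \<Rightarrow> 'a" (infixl "\<star>\<index>" 70)

locale magma =
  fixes M :: "'a magma" (structure)
  assumes star_closed: "\<lbrakk>x \<in> carrier M; y \<in> carrier M\<rbrakk> \<Longrightarrow> x \<star> y \<in> carrier M"

definition magma_hom :: "'a magma \<Rightarrow> 'b magma \<Rightarrow> ('a \<Rightarrow> 'b) set" where
  "magma_hom M N = {h \<in> carrier M \<rightarrow> carrier N.
     \<forall>x\<in>carrier M. \<forall>y\<in>carrier M. h (x \<star>\<^bsub>M\<^esub> y) = h x \<star>\<^bsub>N\<^esub> h y}"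

definition magma_iso :: "'a magma \<Rightarrow> 'b magma \<Rightarrow> ('a \<Rightarrow> 'b) set" where
  "magma_iso M N = {h \<in> magma_hom M N. bij_betw h (carrier M) (carrier N)}"

definition magma_isomorphic :: "'a magma \<Rightarrow> 'b magma \<Rightarrow> bool" where
  "magma_isomorphic M N \<longleftrightarrow> magma_iso M N \<noteq> {}"

locale rack = magma +
  assumes right_translation_auto: "x \<in> carrier M \<Longrightarrow> (\<lambda>y. y \<star> x) \<in> magma_iso M M"

locale quandle = rack +
  assumes star_idem: "x \<in> carrier M \<Longrightarrow> x \<star> x = x"

locale commutative_quandle = quandle +
  assumes star_commute: "\<lbrakk>x \<in> carrier M; y \<in> carrier M\<rbrakk> \<Longrightarrow> x \<star> y = y \<star> x"

locale medial_commutative_quandle = commutative_quandle +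
  assumes star_medial:
    "\<lbrakk>a \<in> carrier M; b \<in> carrier M; c \<in> carrier M; d \<in> carrier M\<rbrakk>
      \<Longrightarrow> (a \<star> b) \<star> (c \<star> d) = (a \<star> c) \<star> (b \<star> d)"


section \<open>Midpoint quandles of modules over the dyadic rationals\<close>

definition dyadics :: "rat set" where
  "dyadics = {of_int a / 2 ^ k | (a :: int) (k :: nat). True}"

definition dyadic_ring :: "rat ring" where
  "dyadic_ring = \<lparr>carrier = dyadics, mult = (*), one = 1, zero = 0, add = (+)\<rparr>"

text \<open>The fields \<open>mult\<close> and \<open>one\<close> of a module record play no role.\<close>

definition dyadic_power :: "nat \<Rightarrow> (rat, nat \<Rightarrow> rat) module" where
  "dyadic_power m =
     \<lparr>carrier = {..<m} \<rightarrow>\<^sub>E dyadics, mult = undefined, one = undefined,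
      zero = (\<lambda>i\<in>{..<m}. 0), add = (\<lambda>x y. \<lambda>i\<in>{..<m}. x i + y i),
      smult = (\<lambda>r x. \<lambda>i\<in>{..<m}. r * x i)\<rparr>"

definition midpoint_quandle :: "(rat, 'm) module \<Rightarrow> 'm magma" where
  "midpoint_quandle M =
     \<lparr>carrier = carrier M, star = (\<lambda>x y. (1/2) \<odot>\<^bsub>M\<^esub> (x \<oplus>\<^bsub>M\<^esub> y))\<rparr>"

lemma dyadicsI: "x = of_int a / 2 ^ k \<Longrightarrow> x \<in> dyadics"
  unfolding dyadics_def by blast

lemma dyadics_closed:
  assumes "x \<in> dyadics" "y \<in> dyadics"
  shows "x + y \<in> dyadics" "x * y \<in> dyadics" "- x \<in> dyadics"
proof -
  obtain a k b l where x: "x = of_int a / 2 ^ k" and y: "y = of_int b / 2 ^ l"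
    using assms unfolding dyadics_def by blast
  show "x + y \<in> dyadics"
    by (rule dyadicsI[of _ "a * 2 ^ l + b * 2 ^ k" "k + l"])
      (simp add: x y field_simps power_add)
  show "x * y \<in> dyadics"
    by (rule dyadicsI[of _ "a * b" "k + l"]) (simp add: x y power_add)
  show "- x \<in> dyadics"
    by (rule dyadicsI[of _ "- a" k]) (simp add: x)
qed

lemma of_int_dyadics: "of_int a \<in> dyadics"
  by (rule dyadicsI[of _ a 0]) simp

lemma zero_one_dyadics: "0 \<in> dyadics" "1 \<in> dyadics"
  using of_int_dyadics[of 0] of_int_dyadics[of 1] by auto

lemma cring_dyadic_ring: "cring dyadic_ring"
  by (rule cringI; (rule abelian_groupI comm_monoidI)?)
    (auto simp: dyadic_ring_def zero_one_dyadics dyadics_closed algebra_simps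
      intro!: bexI[of _ "- _"])

lemma module_dyadic_power: "module dyadic_ring (dyadic_power m)"
proof (rule module.intro)
  show "cring dyadic_ring" by (rule cring_dyadic_ring)
  show "abelian_group (dyadic_power m)"
  proof (rule abelian_groupI)
    fix x assume "x \<in> carrier (dyadic_power m)"
    then show "\<exists>y\<in>carrier (dyadic_power m). y \<oplus>\<^bsub>dyadic_power m\<^esub> x = \<zero>\<^bsub>dyadic_power m\<^esub>"
      by (intro bexI[of _ "\<lambda>i\<in>{..<m}. - x i"])
        (auto simp: dyadic_power_def PiE_iff intro!: dyadics_closed(3))
  qed (auto simp: dyadic_power_def PiE_iff dyadics_closed zero_one_dyadics
      extensional_def fun_eq_iff)
  show "module_axioms dyadic_ring (dyadic_power m)"
    by unfold_locales
      (auto simp: dyadic_power_def dyadic_ring_def PiE_iff dyadics_closed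
        extensional_def fun_eq_iff algebra_simps)
qed


section \<open>Free objects\<close>

text \<open>Homomorphisms are total functions, so uniqueness is uniqueness on the carrier.\<close>

definition unique_extensions :: "'x set \<Rightarrow> 'f magma \<Rightarrow> ('x \<Rightarrow> 'f) \<Rightarrow> 'q magma \<Rightarrow> bool" where
  "unique_extensions X F \<iota> Q \<longleftrightarrow>
     (\<forall>f \<in> X \<rightarrow> carrier Q.
        \<exists>!h. h \<in> magma_hom F Q \<and> h \<in> extensional (carrier F) \<and> (\<forall>x\<in>X. h (\<iota> x) = f x))"

text \<open>
  A formula cannot quantify over types, so the targets of the universal property range
  over the quandles whose carrier is contained in a given type \<open>'q\<close>. The free object itself
  satisfies the predicates below for every type \<open>'q\<close>; see
  \<open>free_commutative_quandle_terms\<close> and \<open>free_medial_commutative_quandle_terms\<close>.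
  A theorem about a free object \<open>F :: 'f magma\<close> may therefore assume any choice of instances,
  and the fewer it assumes, the stronger it is. Taking \<open>'q = 'f\<close> allows \<open>F\<close> itself as a
  target, and \<open>'q = nat\<close> allows a copy of every countable quandle.
\<close>

definition free_commutative_quandle ::
    "'q itself \<Rightarrow> 'x set \<Rightarrow> 'f magma \<Rightarrow> ('x \<Rightarrow> 'f) \<Rightarrow> bool" where
  "free_commutative_quandle (_ :: 'q itself) X F \<iota> \<longleftrightarrow>
     commutative_quandle F \<and> \<iota> \<in> X \<rightarrow> carrier F \<and> inj_on \<iota> X \<and>
     (\<forall>Q :: 'q magma. commutative_quandle Q \<longrightarrow> unique_extensions X F \<iota> Q)"

definition free_medial_commutative_quandle ::
    "'q itself \<Rightarrow> 'x set \<Rightarrow> 'f magma \<Rightarrow> ('x \<Rightarrow> 'f) \<Rightarrow> bool" where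
  "free_medial_commutative_quandle (_ :: 'q itself) X F \<iota> \<longleftrightarrow>
     medial_commutative_quandle F \<and> \<iota> \<in> X \<rightarrow> carrier F \<and> inj_on \<iota> X \<and>
     (\<forall>Q :: 'q magma. medial_commutative_quandle Q \<longrightarrow> unique_extensions X F \<iota> Q)"


section \<open>Existence of the free objects\<close>

text \<open>
  Terms over \<open>X\<close> modulo the equational theory; \<open>Div a b\<close> stands for the preimage of \<open>a\<close>
  under right translation by \<open>b\<close>. The flag \<open>md\<close> switches the medial law on.
\<close>

datatype 'x trm = Gen 'x | Star "'x trm" "'x trm" | Div "'x trm" "'x trm"

inductive teq :: "bool \<Rightarrow> 'x trm \<Rightarrow> 'x trm \<Rightarrow> bool" for md where
  refl: "teq md a a"
| sym: "teq md a b \<Longrightarrow> teq md b a"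
| trans: "teq md a b \<Longrightarrow> teq md b c \<Longrightarrow> teq md a c"
| cong_Star: "teq md a a' \<Longrightarrow> teq md b b' \<Longrightarrow> teq md (Star a b) (Star a' b')"
| cong_Div: "teq md a a' \<Longrightarrow> teq md b b' \<Longrightarrow> teq md (Div a b) (Div a' b')"
| idem: "teq md (Star a a) a"
| commute: "teq md (Star a b) (Star b a)"
| Div_Star: "teq md (Div (Star a b) b) a"
| Star_Div: "teq md (Star (Div a b) b) a"
| distrib: "teq md (Star (Star a b) c) (Star (Star a c) (Star b c))"
| medial: "md \<Longrightarrow> teq md (Star (Star a b) (Star c d)) (Star (Star a c) (Star b d))"

definition tcls :: "bool \<Rightarrow> 'x trm \<Rightarrow> 'x trm set" where
  "tcls md t = {s. teq md t s}"

definition term_quandle :: "bool \<Rightarrow> 'x set \<Rightarrow> 'x trm set magma" where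
  "term_quandle md X =
     \<lparr>carrier = tcls md ` {t. set_trm t \<subseteq> X},
      star = (\<lambda>A B. {s. \<exists>a\<in>A. \<exists>b\<in>B. teq md (Star a b) s})\<rparr>"

lemma tcls_eq: "tcls md s = tcls md t \<longleftrightarrow> teq md s t"
  unfolding tcls_def by (auto intro: teq.intros)

lemma tcls_star: "tcls md a \<star>\<^bsub>term_quandle md X\<^esub> tcls md b = tcls md (Star a b)"
  unfolding term_quandle_def tcls_def by (auto intro: teq.intros)

lemma carrier_term_quandle: "carrier (term_quandle md X) = tcls md ` {t. set_trm t \<subseteq> X}"
  by (simp add: term_quandle_def)

lemma commutative_quandle_term_quandle: "commutative_quandle (term_quandle md X)"
proof (unfold_locales; (unfold carrier_term_quandle)?)
  fix x assume "x \<in> tcls md ` {t. set_trm t \<subseteq> X}"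
  then obtain c where c: "x = tcls md c" "set_trm c \<subseteq> X" by blast
  have closed: "set_trm (Star a c) \<subseteq> X" if "set_trm a \<subseteq> X" for a
    using that c by simp
  have inj: "teq md a b" if "teq md (Star a c) (Star b c)" for a b
    by (meson that teq.intros)
  show "(\<lambda>y. y \<star>\<^bsub>term_quandle md X\<^esub> x) \<in> magma_iso (term_quandle md X) (term_quandle md X)"
    unfolding magma_iso_def bij_betw_def mem_Collect_eq
  proof (intro conjI)
    show hom: "(\<lambda>y. y \<star>\<^bsub>term_quandle md X\<^esub> x) \<in> magma_hom (term_quandle md X) (term_quandle md X)"
      unfolding magma_hom_def carrier_term_quandle
      by (simp add: c tcls_star tcls_eq teq.distrib Pi_def image_iff) (metis closed tcls_star)
    show "inj_on (\<lambda>y. y \<star>\<^bsub>term_quandle md X\<^esub> x) (carrier (term_quandle md X))"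
      by (auto simp: c inj_on_def carrier_term_quandle tcls_star tcls_eq intro: inj)
    show "(\<lambda>y. y \<star>\<^bsub>term_quandle md X\<^esub> x) ` carrier (term_quandle md X) =
            carrier (term_quandle md X)"
    proof (intro equalityI subsetI)
      fix A assume "A \<in> carrier (term_quandle md X)"
      then obtain a where a: "A = tcls md a" "set_trm a \<subseteq> X"
        by (auto simp: carrier_term_quandle)
      have "A = tcls md (Div a c) \<star>\<^bsub>term_quandle md X\<^esub> x"
        by (auto simp: a c tcls_star tcls_eq intro: teq.intros)
      moreover have "tcls md (Div a c) \<in> carrier (term_quandle md X)"
        unfolding carrier_term_quandle using a c by (intro imageI) auto
      ultimately show "A \<in> (\<lambda>y. y \<star>\<^bsub>term_quandle md X\<^esub> x) ` carrier (term_quandle md X)"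
        by blast
    qed (use hom in \<open>auto simp: magma_hom_def\<close>)
  qed
next
  fix x y
  assume "x \<in> tcls md ` {t. set_trm t \<subseteq> X}" "y \<in> tcls md ` {t. set_trm t \<subseteq> X}"
  then obtain a b where ab: "x = tcls md a" "y = tcls md b" "set_trm a \<subseteq> X" "set_trm b \<subseteq> X"
    by blast
  then have "set_trm (Star a b) \<subseteq> X" by simp
  then show "x \<star>\<^bsub>term_quandle md X\<^esub> y \<in> tcls md ` {t. set_trm t \<subseteq> X}"
    unfolding ab(1,2) tcls_star by (intro imageI CollectI)
  show "x \<star>\<^bsub>term_quandle md X\<^esub> y = y \<star>\<^bsub>term_quandle md X\<^esub> x"
    by (simp add: ab(1,2) tcls_star tcls_eq teq.commute)
next
  fix x
  assume "x \<in> tcls md ` {t. set_trm t \<subseteq> X}"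
  then obtain a where "x = tcls md a" by blast
  then show "x \<star>\<^bsub>term_quandle md X\<^esub> x = x"
    by (simp add: tcls_star tcls_eq teq.idem)
qed

lemma medial_commutative_quandle_term_quandle:
  fixes X :: "'a set"
  shows "medial_commutative_quandle (term_quandle True X)"
proof -
  interpret commutative_quandle "term_quandle True X"
    by (rule commutative_quandle_term_quandle)
  show ?thesis
  proof unfold_locales
    fix A B C D :: "'a trm set"
    assume "A \<in> carrier (term_quandle True X)" "B \<in> carrier (term_quandle True X)"
      "C \<in> carrier (term_quandle True X)" "D \<in> carrier (term_quandle True X)"
    then obtain a b c d
      where "A = tcls True a" "B = tcls True b" "C = tcls True c" "D = tcls True d"
      by (auto simp: carrier_term_quandle)
    then show "(A \<star>\<^bsub>term_quandle True X\<^esub> B) \<star>\<^bsub>term_quandle True X\<^esub>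
        (C \<star>\<^bsub>term_quandle True X\<^esub> D) = (A \<star>\<^bsub>term_quandle True X\<^esub> C)
        \<star>\<^bsub>term_quandle True X\<^esub> (B \<star>\<^bsub>term_quandle True X\<^esub> D)"
      by (simp add: tcls_star tcls_eq teq.medial)
  qed
qed

primrec teval :: "'q magma \<Rightarrow> ('x \<Rightarrow> 'q) \<Rightarrow> 'x trm \<Rightarrow> 'q" where
  "teval Q f (Gen x) = f x"
| "teval Q f (Star a b) = teval Q f a \<star>\<^bsub>Q\<^esub> teval Q f b"
| "teval Q f (Div a b) =
     inv_into (carrier Q) (\<lambda>y. y \<star>\<^bsub>Q\<^esub> teval Q f b) (teval Q f a)"

context quandle
begin

lemma right_bij: "x \<in> carrier M \<Longrightarrow> bij_betw (\<lambda>y. y \<star> x) (carrier M) (carrier M)"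
  using right_translation_auto by (simp add: magma_iso_def)

lemma right_distrib:
  "\<lbrakk>x \<in> carrier M; y \<in> carrier M; z \<in> carrier M\<rbrakk> \<Longrightarrow> (x \<star> y) \<star> z = (x \<star> z) \<star> (y \<star> z)"
  using right_translation_auto by (simp add: magma_iso_def magma_hom_def)

lemma teval_closed: "(\<And>x. f x \<in> carrier M) \<Longrightarrow> teval M f t \<in> carrier M"
proof (induction t)
  case (Div a b)
  then show ?case
    using right_bij[of "teval M f b"] by (simp add: bij_betw_def) (metis inv_into_into)
qed (auto simp: star_closed)

end

lemma teval_teq:
  assumes "commutative_quandle Q" "md \<Longrightarrow> medial_commutative_quandle Q"
    and f: "\<And>x. f x \<in> carrier Q" and "teq md s t"
  shows "teval Q f s = teval Q f t"
proof -
  interpret commutative_quandle Q by fact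
  note cl = teval_closed[of f, OF f]
  from \<open>teq md s t\<close> show ?thesis
  proof induction
    case (Div_Star a b)
    then show ?case
      using inv_into_f_f[OF bij_betw_imp_inj_on[OF right_bij[OF cl[of b]]] cl[of a]] by simp
  next
    case (Star_Div a b)
    then show ?case
      using f_inv_into_f[of "teval Q f a" "\<lambda>y. y \<star>\<^bsub>Q\<^esub> teval Q f b" "carrier Q"]
        bij_betw_imp_surj_on[OF right_bij[OF cl[of b]]] cl[of a] by simp
  next
    case (medial a b c d)
    then interpret medial_commutative_quandle Q using assms(2) by simp
    show ?case using star_medial[OF cl cl cl cl] by simp
  qed (simp_all add: star_idem cl right_distrib star_commute)
qed

lemma hom_eq_on_term_quandle:
  assumes Q: "commutative_quandle Q"
    and h: "h \<in> magma_hom (term_quandle md X) Q" and k: "k \<in> magma_hom (term_quandle md X) Q"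
    and hk: "\<And>x. x \<in> X \<Longrightarrow> h (tcls md (Gen x)) = k (tcls md (Gen x))"
    and t: "set_trm t \<subseteq> X"
  shows "h (tcls md t) = k (tcls md t)"
proof -
  interpret commutative_quandle Q by fact
  have hs: "g (tcls md (Star a b)) = g (tcls md a) \<star>\<^bsub>Q\<^esub> g (tcls md b)"
    if "set_trm a \<subseteq> X" "set_trm b \<subseteq> X" "g \<in> magma_hom (term_quandle md X) Q" for a b g
    using that by (auto simp: magma_hom_def carrier_term_quandle tcls_star)
  have hc: "g (tcls md a) \<in> carrier Q"
    if "set_trm a \<subseteq> X" "g \<in> magma_hom (term_quandle md X) Q" for a g
    using that by (auto simp: magma_hom_def carrier_term_quandle)
  from t show ?thesis
  proof (induction t)
    case (Star a b) then show ?case using h k by (simp add: hs)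
  next
    case (Div a b)
    have *: "g (tcls md (Div a b)) \<star>\<^bsub>Q\<^esub> g (tcls md b) = g (tcls md a)"
      if "g \<in> magma_hom (term_quandle md X) Q" for g
    proof -
      have "tcls md (Star (Div a b) b) = tcls md a"
        by (simp add: tcls_eq teq.Star_Div)
      then show ?thesis using hs[of "Div a b" b g] that Div.prems by simp
    qed
    have "inj_on (\<lambda>y. y \<star>\<^bsub>Q\<^esub> h (tcls md b)) (carrier Q)"
      using right_bij[OF hc] Div.prems h by (simp add: bij_betw_def)
    then show ?case
      using *[OF h] *[OF k] Div hc[OF Div.prems h] hc[OF Div.prems k]
      by (auto simp: inj_on_def)
  qed (use hk in auto)
qed

lemma unique_extensions_term_quandle:
  fixes Q :: "'q magma" and X :: "'x set"
  assumes Q: "commutative_quandle Q" "md \<Longrightarrow> medial_commutative_quandle Q"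
  shows "unique_extensions X (term_quandle md X) (\<lambda>x. tcls md (Gen x)) Q"
  unfolding unique_extensions_def
proof (intro ballI ex_ex1I)
  interpret commutative_quandle Q by fact
  let ?F = "term_quandle md X"
  fix f assume f: "f \<in> X \<rightarrow> carrier Q"
  show "\<exists>h. h \<in> magma_hom ?F Q \<and> h \<in> extensional (carrier ?F) \<and>
          (\<forall>x\<in>X. h (tcls md (Gen x)) = f x)"
  proof (cases "carrier Q = {}")
    case True
    then have "X = {}" using f by auto
    then have "carrier ?F = {}"
    proof -
      have "set_trm t \<noteq> {}" for t :: "'x trm" by (induction t) auto
      then show ?thesis using \<open>X = {}\<close> by (auto simp: carrier_term_quandle)
    qed
    then show ?thesis using \<open>X = {}\<close>
      by (intro exI[of _ "\<lambda>_. undefined"]) (auto simp: magma_hom_def)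
  next
    case False
    then obtain q where q: "q \<in> carrier Q" by blast
    define g where "g = (\<lambda>x. if x \<in> X then f x else q)"
    have g: "g x \<in> carrier Q" for x using f q by (auto simp: g_def)
    define h where "h = (\<lambda>C\<in>carrier ?F. teval Q g (SOME t. tcls md t = C))"
    have h: "h (tcls md t) = teval Q g t" if "set_trm t \<subseteq> X" for t
    proof -
      have "tcls md (SOME s. tcls md s = tcls md t) = tcls md t"
        by (rule someI) (rule HOL.refl)
      then have "teval Q g (SOME s. tcls md s = tcls md t) = teval Q g t"
        unfolding tcls_eq by (rule teval_teq[OF Q g, rotated])
      then show ?thesis using that by (auto simp: h_def carrier_term_quandle)
    qed
    have "h \<in> magma_hom ?F Q"
      by (auto simp: magma_hom_def carrier_term_quandle tcls_star h teval_closed g)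
    moreover have "h (tcls md (Gen x)) = f x" if "x \<in> X" for x
      using that by (simp add: h g_def)
    ultimately show ?thesis by (intro exI[of _ h]) (auto simp: h_def)
  qed
  fix h k
  assume "h \<in> magma_hom ?F Q \<and> h \<in> extensional (carrier ?F) \<and>
            (\<forall>x\<in>X. h (tcls md (Gen x)) = f x)"
    and "k \<in> magma_hom ?F Q \<and> k \<in> extensional (carrier ?F) \<and>
            (\<forall>x\<in>X. k (tcls md (Gen x)) = f x)"
  then show "h = k"
    using hom_eq_on_term_quandle[OF Q(1), of h md X k]
    by (intro extensionalityI[of h "carrier ?F"]) (auto simp: carrier_term_quandle)
qed

lemma medial_commutative_quandle_rat:
  "medial_commutative_quandle \<lparr>carrier = UNIV, star = (\<lambda>x y :: rat. (x + y) / 2)\<rparr>"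
proof -
  have "bij (\<lambda>y :: rat. (y + x) / 2)" for x
    by (rule bij_betw_byWitness[where f' = "\<lambda>y. 2 * y - x"]) (auto simp: field_simps)
  then show ?thesis
    by unfold_locales (auto simp: magma_iso_def magma_hom_def field_simps)
qed

lemma inj_tcls_Gen: "inj_on (\<lambda>x. tcls md (Gen x)) X"
proof (rule inj_onI, rule ccontr)
  fix x y :: 'a assume eq: "tcls md (Gen x) = tcls md (Gen y)" and "x \<noteq> y"
  let ?Q = "\<lparr>carrier = UNIV, star = (\<lambda>x y :: rat. (x + y) / 2)\<rparr>"
  interpret medial_commutative_quandle ?Q by (rule medial_commutative_quandle_rat)
  have "teval ?Q (\<lambda>z. if z = x then 1 else 0) (Gen x) =
        teval ?Q (\<lambda>z. if z = x then 1 else 0) (Gen y)"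
    by (rule teval_teq[OF _ _ _ eq[unfolded tcls_eq]]) (unfold_locales, auto)
  with \<open>x \<noteq> y\<close> show False by simp
qed

theorem free_commutative_quandle_terms:
  "free_commutative_quandle TYPE('q) X (term_quandle False X) (\<lambda>x. tcls False (Gen x))"
  unfolding free_commutative_quandle_def
  by (auto simp: commutative_quandle_term_quandle inj_tcls_Gen carrier_term_quandle
      intro!: unique_extensions_term_quandle)

theorem free_medial_commutative_quandle_terms:
  "free_medial_commutative_quandle TYPE('q) X (term_quandle True X) (\<lambda>x. tcls True (Gen x))"
  unfolding free_medial_commutative_quandle_def
  by (auto simp: medial_commutative_quandle_term_quandle inj_tcls_Gen carrier_term_quandle
      medial_commutative_quandle.axioms(1) intro!: unique_extensions_term_quandle)

end

theory Submission
  imports Defs "HOL-Library.Countable_Set"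
begin

text \<open>
  The reason for the isomorphism \<open>F \<cong> G\<close> is that a commutative quandle generated by at most three
  elements is medial (\<open>medial_if_three_generators\<close>). Every right translation is an automorphism,
  so for fixed \<open>b\<close>, \<open>c\<close>, \<open>d\<close> both sides of \<open>(x \<star> b) \<star> (c \<star> d) = (x \<star> c) \<star> (b \<star> d)\<close> are
  automorphisms applied to \<open>x\<close>, and the set of \<open>x\<close> satisfying the equation is a subquandle.
  By commutativity the same holds for each of the four arguments, so the medial law needs to be
  checked on generators only. Four elements taken from three generators contain a repetition, and
  with a repeated argument the medial law is trivial or a case of self-distributivity or of
  commutativity.
  A free commutative quandle is generated by its basis
  (\<open>carrier_eq_span_if_unique_extensions\<close>); so on at most three generators it is medial, and
  then it is a free medial commutative quandle as well (\<open>free_commutative_is_free_medial\<close>).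

  It remains to identify the free medial commutative quandle \<open>G\<close> on \<open>m + 1\<close> generators
  \<open>e, a\<^sub>0, \<dots>\<close> with \<open>\<D>\<^sup>m\<close>, for any \<open>m\<close> (\<open>free_medial_isomorphic_dyadic_power\<close>). Taking \<open>e\<close> as origin,
  the medial law makes \<open>x + y\<close>, the solution \<open>z\<close> of \<open>z \<star> e = x \<star> y\<close>, an abelian group operation for
  which \<open>x \<mapsto> x \<star> e\<close> is an automorphism inverse to doubling. Every element is therefore an
  iterated half of an integer combination of the \<open>a\<^sub>i\<close> (\<open>span_eq_halved_subgroup\<close>). The homomorphism
  \<open>G \<rightarrow> \<D>\<^sup>m\<close> sending \<open>e\<close> to the origin and \<open>a\<^sub>i\<close> to the \<open>i\<close>-th unit vector is additive, so it takes such
  an element to its coefficients divided by a power of two. This shows that it is injective, and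
  it is surjective because finitely many dyadic rationals have a common denominator.
\<close>

section \<open>Division, generated subquandles and copies\<close>

definition rdiv :: "'a magma \<Rightarrow> 'a \<Rightarrow> 'a \<Rightarrow> 'a" where
  "rdiv Q x y = inv_into (carrier Q) (\<lambda>z. z \<star>\<^bsub>Q\<^esub> y) x"

text \<open>
  Closure under \<open>star\<close> alone need not make the right translations of the subset surjective (the
  nonnegative rationals under midpoints are an example); the last rule makes them so.
\<close>

inductive_set quandle_span :: "'a magma \<Rightarrow> 'a set \<Rightarrow> 'a set" for Q A where
  base: "a \<in> A \<Longrightarrow> a \<in> carrier Q \<Longrightarrow> a \<in> quandle_span Q A"
| star: "x \<in> quandle_span Q A \<Longrightarrow> y \<in> quandle_span Q A \<Longrightarrow> x \<star>\<^bsub>Q\<^esub> y \<in> quandle_span Q A"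
| div: "y \<star>\<^bsub>Q\<^esub> x \<in> quandle_span Q A \<Longrightarrow> x \<in> quandle_span Q A \<Longrightarrow> y \<in> carrier Q
    \<Longrightarrow> y \<in> quandle_span Q A"

context quandle
begin

lemma right_cancel:
  "\<lbrakk>x \<star> z = y \<star> z; x \<in> carrier M; y \<in> carrier M; z \<in> carrier M\<rbrakk> \<Longrightarrow> x = y"
  using right_bij[of z] by (auto simp: bij_betw_def inj_on_def)

lemma rdiv_closed: "\<lbrakk>x \<in> carrier M; y \<in> carrier M\<rbrakk> \<Longrightarrow> rdiv M x y \<in> carrier M"
  unfolding rdiv_def using right_bij[of y] by (metis bij_betw_def inv_into_into)

lemma rdiv_star: "\<lbrakk>x \<in> carrier M; y \<in> carrier M\<rbrakk> \<Longrightarrow> rdiv M x y \<star> y = x"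
  unfolding rdiv_def using right_bij[of y] f_inv_into_f[of x "\<lambda>z. z \<star> y" "carrier M"]
  by (simp add: bij_betw_def)

lemma span_subset: "x \<in> quandle_span M A \<Longrightarrow> x \<in> carrier M"
  by (induction rule: quandle_span.induct) (auto simp: star_closed)

end

text \<open>
  The axioms spelled out elementwise, with bijectivity of right translations split into
  cancellation and solvability.
\<close>

lemma commutative_quandleI:
  assumes closed: "\<And>x y. \<lbrakk>x \<in> carrier Q; y \<in> carrier Q\<rbrakk> \<Longrightarrow> x \<star>\<^bsub>Q\<^esub> y \<in> carrier Q"
    and distrib: "\<And>x y z. \<lbrakk>x \<in> carrier Q; y \<in> carrier Q; z \<in> carrier Q\<rbrakk>
      \<Longrightarrow> (x \<star>\<^bsub>Q\<^esub> y) \<star>\<^bsub>Q\<^esub> z = (x \<star>\<^bsub>Q\<^esub> z) \<star>\<^bsub>Q\<^esub> (y \<star>\<^bsub>Q\<^esub> z)"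
    and cancel: "\<And>x y z. \<lbrakk>x \<in> carrier Q; y \<in> carrier Q; z \<in> carrier Q; x \<star>\<^bsub>Q\<^esub> z = y \<star>\<^bsub>Q\<^esub> z\<rbrakk> \<Longrightarrow> x = y"
    and solve: "\<And>x z. \<lbrakk>x \<in> carrier Q; z \<in> carrier Q\<rbrakk> \<Longrightarrow> \<exists>y\<in>carrier Q. y \<star>\<^bsub>Q\<^esub> z = x"
    and idem: "\<And>x. x \<in> carrier Q \<Longrightarrow> x \<star>\<^bsub>Q\<^esub> x = x"
    and commute: "\<And>x y. \<lbrakk>x \<in> carrier Q; y \<in> carrier Q\<rbrakk> \<Longrightarrow> x \<star>\<^bsub>Q\<^esub> y = y \<star>\<^bsub>Q\<^esub> x"
  shows "commutative_quandle Q"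
proof unfold_locales
  fix x assume x: "x \<in> carrier Q"
  have "inj_on (\<lambda>y. y \<star>\<^bsub>Q\<^esub> x) (carrier Q)"
    by (rule inj_onI) (rule cancel[OF _ _ x])
  moreover have "(\<lambda>y. y \<star>\<^bsub>Q\<^esub> x) ` carrier Q = carrier Q"
    using solve[OF _ x] closed[OF _ x] by force
  ultimately have "bij_betw (\<lambda>y. y \<star>\<^bsub>Q\<^esub> x) (carrier Q) (carrier Q)"
    by (simp add: bij_betw_def)
  moreover have "(\<lambda>y. y \<star>\<^bsub>Q\<^esub> x) \<in> magma_hom Q Q"
    unfolding magma_hom_def using distrib[OF _ _ x] closed[OF _ x] by blast
  ultimately show "(\<lambda>y. y \<star>\<^bsub>Q\<^esub> x) \<in> magma_iso Q Q"
    by (simp add: magma_iso_def)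
qed (fact closed idem commute)+

lemma medial_commutative_quandleI:
  assumes "commutative_quandle Q"
    and "\<And>a b c d. \<lbrakk>a \<in> carrier Q; b \<in> carrier Q; c \<in> carrier Q; d \<in> carrier Q\<rbrakk> \<Longrightarrow>
      (a \<star>\<^bsub>Q\<^esub> b) \<star>\<^bsub>Q\<^esub> (c \<star>\<^bsub>Q\<^esub> d) = (a \<star>\<^bsub>Q\<^esub> c) \<star>\<^bsub>Q\<^esub> (b \<star>\<^bsub>Q\<^esub> d)"
  shows "medial_commutative_quandle Q"
  using assms by (auto simp: medial_commutative_quandle_def medial_commutative_quandle_axioms_def)

lemma commutative_quandle_span:
  assumes "commutative_quandle Q"
  shows "commutative_quandle (Q\<lparr>carrier := quandle_span Q A\<rparr>)"
proof -
  interpret commutative_quandle Q by fact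
  let ?S = "quandle_span Q A" and ?Q = "Q\<lparr>carrier := quandle_span Q A\<rparr>"
  have sub: "x \<in> carrier Q" if "x \<in> carrier ?Q" for x using that span_subset by simp
  have S: "carrier ?Q = ?S" "star ?Q = star Q" by simp_all
  show ?thesis
  proof (rule commutative_quandleI; unfold S(2))
    fix x y assume "x \<in> carrier ?Q" "y \<in> carrier ?Q"
    then show "x \<star>\<^bsub>Q\<^esub> y \<in> carrier ?Q" unfolding S by (rule quandle_span.star)
  next
    fix x z assume xz: "x \<in> carrier ?Q" "z \<in> carrier ?Q"
    then have eq: "rdiv Q x z \<star>\<^bsub>Q\<^esub> z = x" by (intro rdiv_star sub)
    have "rdiv Q x z \<in> ?S"
    proof (rule quandle_span.div)
      show "rdiv Q x z \<star>\<^bsub>Q\<^esub> z \<in> ?S" "z \<in> ?S" using xz unfolding S eq by auto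
      show "rdiv Q x z \<in> carrier Q" using xz by (intro rdiv_closed sub)
    qed
    then show "\<exists>y\<in>carrier ?Q. y \<star>\<^bsub>Q\<^esub> z = x" using eq unfolding S by (rule bexI[rotated])
  next
    fix x y z assume "x \<in> carrier ?Q" "y \<in> carrier ?Q" "z \<in> carrier ?Q"
      and "x \<star>\<^bsub>Q\<^esub> z = y \<star>\<^bsub>Q\<^esub> z"
    then show "x = y" by (intro right_cancel[of x z y] sub)
  qed (intro right_distrib star_idem star_commute sub, assumption+)+
qed

lemma medial_commutative_quandle_span:
  assumes "medial_commutative_quandle Q"
  shows "medial_commutative_quandle (Q\<lparr>carrier := quandle_span Q A\<rparr>)"
proof -
  interpret medial_commutative_quandle Q by fact
  show ?thesis
    by (rule medial_commutative_quandleI)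
      (auto simp: commutative_quandle_span commutative_quandle_axioms star_medial span_subset)
qed

text \<open>
  A homomorphism extending \<open>\<iota>\<close> into the subquandle generated by the image of \<open>\<iota>\<close> is, read as
  an endomorphism of \<open>F\<close>, the identity by uniqueness; so that subquandle is everything.
\<close>

lemma carrier_eq_span_if_unique_extensions:
  assumes "quandle F" and \<iota>: "\<iota> \<in> X \<rightarrow> carrier F"
    and self: "unique_extensions X F \<iota> F"
    and span: "unique_extensions X F \<iota> (F\<lparr>carrier := quandle_span F (\<iota> ` X)\<rparr>)"
  shows "carrier F = quandle_span F (\<iota> ` X)"
proof -
  interpret quandle F by fact
  let ?S = "quandle_span F (\<iota> ` X)"
  have "\<iota> \<in> X \<rightarrow> carrier (F\<lparr>carrier := ?S\<rparr>)"
    using \<iota> by (auto intro: quandle_span.base)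
  then obtain h where h: "h \<in> magma_hom F (F\<lparr>carrier := ?S\<rparr>)" "h \<in> extensional (carrier F)"
      "\<forall>x\<in>X. h (\<iota> x) = \<iota> x"
    using span unfolding unique_extensions_def by blast
  have "h \<in> magma_hom F F"
    using h(1) span_subset by (auto simp: magma_hom_def)
  moreover have "restrict id (carrier F) \<in> magma_hom F F"
    by (auto simp: magma_hom_def star_closed)
  moreover have "\<forall>x\<in>X. restrict id (carrier F) (\<iota> x) = \<iota> x"
    using \<iota> by auto
  ultimately have "h = restrict id (carrier F)"
    using self \<iota> h unfolding unique_extensions_def by (metis restrict_extensional)
  then have "carrier F \<subseteq> ?S"
    using h(1) by (auto simp: magma_hom_def Pi_def)
  then show ?thesis using span_subset by blast
qed

text \<open>
  Transport of structure along an injection. It moves a quandle to another carrier type, where a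
  universal property is available.
\<close>

lemma medial_commutative_quandle_copy:
  fixes Q :: "'a magma" and e :: "'a \<Rightarrow> 'b"
  assumes Q: "medial_commutative_quandle Q" and e: "inj_on e (carrier Q)"
  obtains N :: "'b magma" and d where "medial_commutative_quandle N" "e \<in> carrier Q \<rightarrow> carrier N"
    "d \<in> magma_hom N Q" "\<And>x. x \<in> carrier Q \<Longrightarrow> d (e x) = x"
proof -
  interpret medial_commutative_quandle Q by fact
  define d where "d = inv_into (carrier Q) e"
  have d: "d (e x) = x" if "x \<in> carrier Q" for x using e that by (simp add: d_def)
  define N where "N = \<lparr>carrier = e ` carrier Q, star = (\<lambda>x y. e (d x \<star>\<^bsub>Q\<^esub> d y))\<rparr>"
  have N_star: "e a \<star>\<^bsub>N\<^esub> e b = e (a \<star>\<^bsub>Q\<^esub> b)" if "a \<in> carrier Q" "b \<in> carrier Q" for a b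
    using that by (simp add: N_def d)
  have N_carrier: "carrier N = e ` carrier Q" by (simp add: N_def)
  have "commutative_quandle N"
  proof (rule commutative_quandleI; unfold N_carrier; elim imageE; hypsubst)
    fix a b assume "a \<in> carrier Q" "b \<in> carrier Q"
    then show "\<exists>y\<in>e ` carrier Q. y \<star>\<^bsub>N\<^esub> e b = e a"
      by (intro bexI[of _ "e (rdiv Q a b)"]) (auto simp: N_star rdiv_star rdiv_closed)
  next
    fix a b c assume abc: "a \<in> carrier Q" "b \<in> carrier Q" "c \<in> carrier Q"
    then show "e a \<star>\<^bsub>N\<^esub> e b \<star>\<^bsub>N\<^esub> e c = e a \<star>\<^bsub>N\<^esub> e c \<star>\<^bsub>N\<^esub> (e b \<star>\<^bsub>N\<^esub> e c)"
      using right_distrib[of a b c] by (simp add: N_star star_closed)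
    assume "e a \<star>\<^bsub>N\<^esub> e c = e b \<star>\<^bsub>N\<^esub> e c"
    then have "a \<star>\<^bsub>Q\<^esub> c = b \<star>\<^bsub>Q\<^esub> c"
      using abc by (simp add: N_star star_closed inj_on_eq_iff[OF e])
    then have "a = b" by (rule right_cancel) (rule abc)+
    then show "e a = e b" by simp
  qed (auto simp: N_star star_closed star_idem star_commute)
  then have "medial_commutative_quandle N"
  proof (rule medial_commutative_quandleI; unfold N_carrier; elim imageE; hypsubst)
    fix a b c d assume "a \<in> carrier Q" "b \<in> carrier Q" "c \<in> carrier Q" "d \<in> carrier Q"
    then show "e a \<star>\<^bsub>N\<^esub> e b \<star>\<^bsub>N\<^esub> (e c \<star>\<^bsub>N\<^esub> e d) = e a \<star>\<^bsub>N\<^esub> e c \<star>\<^bsub>N\<^esub> (e b \<star>\<^bsub>N\<^esub> e d)"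
      using star_medial[of a b c d] by (simp add: N_star star_closed)
  qed
  moreover have "d \<in> magma_hom N Q"
    by (auto simp: magma_hom_def N_def d star_closed)
  ultimately show ?thesis using d that by (auto simp: N_def)
qed


section \<open>Mediality from generators\<close>

text \<open>
  The equalizer of two homomorphisms is closed under division because the target is cancellative.
\<close>

lemma homs_eq_on_span:
  assumes "quandle M" "quandle N"
    and f: "f \<in> magma_hom M N" and g: "g \<in> magma_hom M N"
    and A: "\<And>a. a \<in> A \<Longrightarrow> a \<in> carrier M \<Longrightarrow> f a = g a" and x: "x \<in> quandle_span M A"
  shows "f x = g x"
proof -
  interpret M: quandle M by fact
  interpret N: quandle N by fact
  have hom: "k (y \<star>\<^bsub>M\<^esub> z) = k y \<star>\<^bsub>N\<^esub> k z" "k y \<in> carrier N"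
    if "k \<in> magma_hom M N" "y \<in> carrier M" "z \<in> carrier M" for k y z
    using that by (auto simp: magma_hom_def)
  show ?thesis using x
  proof induction
    case (base a) then show ?case using A by blast
  next
    case (star x y)
    then have "x \<in> carrier M" "y \<in> carrier M" using M.span_subset by blast+
    then show ?case using star.IH hom(1)[OF f] hom(1)[OF g] by metis
  next
    case (div y x)
    have x: "x \<in> carrier M" using div.hyps M.span_subset by blast
    have "f y \<star>\<^bsub>N\<^esub> f x = g y \<star>\<^bsub>N\<^esub> f x"
      using hom(1)[OF f div.hyps(3) x] hom(1)[OF g div.hyps(3) x] div.IH by metis
    then show ?case
      by (rule N.right_cancel) (use hom(2) f g x div.hyps(3) in blast)+
  qed
qed

lemma (in quandle) right_translations_comp_hom:
  assumes "b \<in> carrier M" "c \<in> carrier M"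
  shows "(\<lambda>x. (x \<star> b) \<star> c) \<in> magma_hom M M"
  using right_translation_auto[OF assms(1)] right_translation_auto[OF assms(2)]
  by (simp add: magma_iso_def magma_hom_def Pi_iff)

lemma (in commutative_quandle) medial_extends_to_span:
  assumes bcd: "b \<in> carrier M" "c \<in> carrier M" "d \<in> carrier M"
    and A: "\<And>a. a \<in> A \<Longrightarrow> a \<in> carrier M \<Longrightarrow> (a \<star> b) \<star> (c \<star> d) = (a \<star> c) \<star> (b \<star> d)"
    and x: "x \<in> quandle_span M A"
  shows "(x \<star> b) \<star> (c \<star> d) = (x \<star> c) \<star> (b \<star> d)"
  by (rule homs_eq_on_span[OF quandle_axioms quandle_axioms _ _ A x])
    (intro right_translations_comp_hom star_closed bcd)+

text \<open>
  The arguments are freed from \<open>A\<close> one at a time. The medial law is invariant, up to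
  commutativity, under the Klein four-group of double transpositions of its arguments, and these
  bring any argument into the first position, where \<open>medial_extends_to_span\<close> applies.
\<close>

lemma (in commutative_quandle) medial_if_generators_medial:
  assumes gen: "carrier M = quandle_span M A"
    and A: "\<And>a b c d. \<lbrakk>a \<in> A; b \<in> A; c \<in> A; d \<in> A;
      a \<in> carrier M; b \<in> carrier M; c \<in> carrier M; d \<in> carrier M\<rbrakk>
      \<Longrightarrow> (a \<star> b) \<star> (c \<star> d) = (a \<star> c) \<star> (b \<star> d)"
  shows "medial_commutative_quandle M"
proof -
  define med where "med a b c d \<longleftrightarrow> (a \<star> b) \<star> (c \<star> d) = (a \<star> c) \<star> (b \<star> d)" for a b c d
  have extend: "med x b c d"
    if "\<And>a. a \<in> A \<Longrightarrow> a \<in> carrier M \<Longrightarrow> med a b c d"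
      and "x \<in> carrier M" "b \<in> carrier M" "c \<in> carrier M" "d \<in> carrier M" for x b c d
    unfolding med_def
    by (rule medial_extends_to_span[where A = A]) (use that gen in \<open>auto simp: med_def\<close>)
  have sym2: "med b a d c" and sym3: "med c d a b" and sym4: "med d c b a"
    if "med a b c d" "a \<in> carrier M" "b \<in> carrier M" "c \<in> carrier M" "d \<in> carrier M" for a b c d
    using that unfolding med_def by (metis star_closed star_commute)+
  have 0: "med a b c d" if "a \<in> A" "b \<in> A" "c \<in> A" "d \<in> A"
      "a \<in> carrier M" "b \<in> carrier M" "c \<in> carrier M" "d \<in> carrier M" for a b c d
    using A that by (simp add: med_def)
  have 1: "med a b c d" if "b \<in> A" "c \<in> A" "d \<in> A"
      "a \<in> carrier M" "b \<in> carrier M" "c \<in> carrier M" "d \<in> carrier M" for a b c d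
    by (rule extend) (use that 0 in auto)
  have 2: "med a b c d" if "c \<in> A" "d \<in> A"
      "a \<in> carrier M" "b \<in> carrier M" "c \<in> carrier M" "d \<in> carrier M" for a b c d
    by (rule sym2, rule extend, rule sym2, rule 1) (use that in auto)
  have 3: "med a b c d" if "d \<in> A"
      "a \<in> carrier M" "b \<in> carrier M" "c \<in> carrier M" "d \<in> carrier M" for a b c d
    by (rule sym3, rule extend, rule sym3, rule 2) (use that in auto)
  have 4: "med a b c d"
    if "a \<in> carrier M" "b \<in> carrier M" "c \<in> carrier M" "d \<in> carrier M" for a b c d
    by (rule sym4, rule extend, rule sym4, rule 3) (use that in auto)
  show ?thesis
    by (rule medial_commutative_quandleI[OF commutative_quandle_axioms 4[unfolded med_def]])
qed

lemma (in commutative_quandle) medial_if_equal_arguments: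
  assumes abcd: "a \<in> carrier M" "b \<in> carrier M" "c \<in> carrier M" "d \<in> carrier M"
    and eq: "card {a, b, c, d} \<le> 3"
  shows "(a \<star> b) \<star> (c \<star> d) = (a \<star> c) \<star> (b \<star> d)"
proof -
  have ldist: "x \<star> (y \<star> z) = (x \<star> y) \<star> (x \<star> z)"
    if "x \<in> carrier M" "y \<in> carrier M" "z \<in> carrier M" for x y z
    using that right_distrib by (metis star_closed star_commute)
  consider "a = b" | "a = c" | "a = d" | "b = c" | "b = d" | "c = d"
    using eq by (auto simp: card_insert_if split: if_splits)
  then show ?thesis
  proof cases
    case 1 then show ?thesis using abcd ldist[of b c d] star_idem by simp
  next
    case 2 then show ?thesis using abcd ldist[of c b d] star_idem by simp
  next
    case 3 then show ?thesis using abcd by (metis star_closed star_commute)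
  next
    case 4 then show ?thesis by simp
  next
    case 5 then show ?thesis using abcd right_distrib[of a c b] star_idem by simp
  next
    case 6 then show ?thesis using abcd right_distrib[of a b c] star_idem by simp
  qed
qed

text \<open>By the pigeonhole principle, four generators never are pairwise distinct here.\<close>

theorem (in commutative_quandle) medial_if_three_generators:
  assumes gen: "carrier M = quandle_span M A" and A: "finite A" "card A \<le> 3"
  shows "medial_commutative_quandle M"
proof (rule medial_if_generators_medial[OF gen])
  fix a b c d assume in_A: "a \<in> A" "b \<in> A" "c \<in> A" "d \<in> A"
    and C: "a \<in> carrier M" "b \<in> carrier M" "c \<in> carrier M" "d \<in> carrier M"
  have "card {a, b, c, d} \<le> card A" using A in_A by (intro card_mono) auto
  with A show "(a \<star> b) \<star> (c \<star> d) = (a \<star> c) \<star> (b \<star> d)"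
    by (intro medial_if_equal_arguments C) simp
qed


section \<open>The abelian group of a pointed medial commutative quandle\<close>

text \<open>
  The sum \<open>x + y\<close> completes the parallelogram with vertices \<open>e\<close>, \<open>x\<close>, \<open>y\<close>: its midpoint with the
  origin \<open>e\<close> is the midpoint of \<open>x\<close> and \<open>y\<close>.
\<close>

definition pointed_group :: "'a magma \<Rightarrow> 'a \<Rightarrow> 'a monoid" where
  "pointed_group Q e = \<lparr>carrier = carrier Q, mult = (\<lambda>x y. rdiv Q (x \<star>\<^bsub>Q\<^esub> y) e), one = e\<rparr>"

locale pointed_medial_quandle = medial_commutative_quandle +
  fixes e
  assumes e: "e \<in> carrier M"
begin

abbreviation P where "P \<equiv> pointed_group M e"

lemma carrier_P [simp]: "carrier P = carrier M" and one_P: "\<one>\<^bsub>P\<^esub> = e"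
  by (simp_all add: pointed_group_def)

lemma mult_halved: "\<lbrakk>x \<in> carrier M; y \<in> carrier M\<rbrakk> \<Longrightarrow> (x \<otimes>\<^bsub>P\<^esub> y) \<star> e = x \<star> y"
  by (simp add: pointed_group_def rdiv_star star_closed e)

lemma mult_P_closed: "\<lbrakk>x \<in> carrier M; y \<in> carrier M\<rbrakk> \<Longrightarrow> x \<otimes>\<^bsub>P\<^esub> y \<in> carrier M"
  by (simp add: pointed_group_def rdiv_closed star_closed e)

lemma mult_eqI: "\<lbrakk>x \<in> carrier M; y \<in> carrier M; z \<in> carrier M; z \<star> e = x \<star> y\<rbrakk> \<Longrightarrow> x \<otimes>\<^bsub>P\<^esub> y = z"
  using right_cancel[of "x \<otimes>\<^bsub>P\<^esub> y" e z] by (simp add: mult_halved mult_P_closed e)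

lemma comm_group_P: "comm_group P"
proof (rule comm_groupI; simp add: one_P e mult_P_closed)
  fix x y z assume C: "x \<in> carrier M" "y \<in> carrier M" "z \<in> carrier M"
  have "((x \<otimes>\<^bsub>P\<^esub> y) \<star> z) \<star> e = (x \<star> y) \<star> (z \<star> e)"
    using C e by (simp add: right_distrib[of _ z e] mult_P_closed mult_halved)
  also have "\<dots> = (x \<star> e) \<star> (y \<star> z)"
    using C e by (metis star_commute star_medial)
  also have "\<dots> = (x \<star> (y \<otimes>\<^bsub>P\<^esub> z)) \<star> e"
    using C e by (simp add: right_distrib[of x _ e] mult_P_closed mult_halved)
  finally have "(x \<otimes>\<^bsub>P\<^esub> y) \<star> z = x \<star> (y \<otimes>\<^bsub>P\<^esub> z)"
    by (rule right_cancel) (use C e in \<open>simp_all add: star_closed mult_P_closed\<close>)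
  then show "x \<otimes>\<^bsub>P\<^esub> y \<otimes>\<^bsub>P\<^esub> z = x \<otimes>\<^bsub>P\<^esub> (y \<otimes>\<^bsub>P\<^esub> z)"
    using C by (intro mult_eqI) (simp_all add: mult_P_closed mult_halved)
next
  fix x y assume "x \<in> carrier M" "y \<in> carrier M"
  then show "x \<otimes>\<^bsub>P\<^esub> y = y \<otimes>\<^bsub>P\<^esub> x"
    by (intro mult_eqI) (simp_all add: mult_P_closed mult_halved star_commute)
next
  fix x assume x: "x \<in> carrier M"
  then show "e \<otimes>\<^bsub>P\<^esub> x = x" using e by (intro mult_eqI) (simp_all add: star_commute)
  show "\<exists>y\<in>carrier M. y \<otimes>\<^bsub>P\<^esub> x = e"
    by (intro bexI[of _ "rdiv M e x"] mult_eqI) (use x e in \<open>simp_all add: rdiv_closed rdiv_star star_idem\<close>)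
qed

sublocale P: comm_group P
  by (rule comm_group_P)

text \<open>
  Since \<open>x \<star> e\<close> is the midpoint of \<open>x\<close> and the origin, this is division by \<open>2\<close> to the power \<open>k\<close>.
\<close>

abbreviation half where "half k \<equiv> (\<lambda>x. x \<star> e) ^^ k"

lemma half_closed: "x \<in> carrier M \<Longrightarrow> half k x \<in> carrier M"
  by (induction k) (auto simp: star_closed e)

lemma half_star: "\<lbrakk>x \<in> carrier M; y \<in> carrier M\<rbrakk> \<Longrightarrow> half k (x \<star> y) = half k x \<star> half k y"
  by (induction k) (auto simp: half_closed e intro: right_distrib)

lemma half_mult:
  assumes "x \<in> carrier M" "y \<in> carrier M"
  shows "half k (x \<otimes>\<^bsub>P\<^esub> y) = half k x \<otimes>\<^bsub>P\<^esub> half k y"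
proof (rule mult_eqI[symmetric])
  have "half k (x \<otimes>\<^bsub>P\<^esub> y) \<star> e = half k ((x \<otimes>\<^bsub>P\<^esub> y) \<star> e)"
    by (metis funpow_swap1)
  then show "half k (x \<otimes>\<^bsub>P\<^esub> y) \<star> e = half k x \<star> half k y"
    using assms by (simp add: mult_halved half_star)
qed (use assms in \<open>simp_all add: half_closed mult_P_closed\<close>)

lemma half_double: "x \<in> carrier M \<Longrightarrow> half (Suc k) (x \<otimes>\<^bsub>P\<^esub> x) = half k x"
  unfolding funpow_Suc_right by (simp add: mult_halved star_idem)

text \<open>
  The halves of elements of \<open>B\<close> form a subquandle: two of them can be brought to the same
  exponent \<open>k\<close> by doubling, and then \<open>x \<star> y = (x + y) / 2\<close> while \<open>y \<star> x = z\<close> is solved by \<open>y = 2 z - x\<close>.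
\<close>

lemma span_eq_halved_subgroup:
  assumes B: "subgroup B P" and A: "\<And>a. a \<in> A \<Longrightarrow> a \<in> B" and x: "x \<in> quandle_span M A"
  shows "\<exists>k. \<exists>u\<in>B. x = half k u"
proof -
  have BC: "u \<in> carrier M" if "u \<in> B" for u
    using subgroup.mem_carrier[OF B that] by simp
  have lift: "\<exists>w\<in>B. half k u = half (k + j) w" if "u \<in> B" for k j u
  proof (induction j)
    case 0 show ?case using that by auto
  next
    case (Suc j)
    then obtain w where "w \<in> B" "half k u = half (k + j) w" by blast
    then show ?case
      using half_double[of w "k + j"] BC subgroup.m_closed[OF B] by (metis add_Suc_right)
  qed
  have common: "\<exists>k. \<exists>u'\<in>B. \<exists>v'\<in>B. half i u = half k u' \<and> half j v = half k v'"
    if "u \<in> B" "v \<in> B" for i j u v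
    using lift[OF that(1), of i j] lift[OF that(2), of j i] by (metis add.commute)
  from x show ?thesis
  proof induction
    case (base a)
    then show ?case using A by (metis funpow_0)
  next
    case (star x y)
    then obtain k u v where uv: "u \<in> B" "v \<in> B" "x = half k u" "y = half k v"
      using common by metis
    have "x \<star> y = half k (half 1 (u \<otimes>\<^bsub>P\<^esub> v))"
      using uv BC by (simp add: half_star mult_halved)
    then have "x \<star> y = half (k + 1) (u \<otimes>\<^bsub>P\<^esub> v)"
      by (simp only: funpow_add comp_apply)
    then show ?case using uv subgroup.m_closed[OF B] by blast
  next
    case (div y x)
    then obtain k u v where uv: "u \<in> B" "v \<in> B" "y \<star> x = half k u" "x = half k v"
      using common by metis
    let ?w = "u \<otimes>\<^bsub>P\<^esub> u \<otimes>\<^bsub>P\<^esub> inv\<^bsub>P\<^esub> v"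
    have w: "?w \<in> B" using uv B by (simp add: subgroup.m_closed subgroup.m_inv_closed)
    have "?w \<otimes>\<^bsub>P\<^esub> v = u \<otimes>\<^bsub>P\<^esub> u"
      using P.m_assoc[of "u \<otimes>\<^bsub>P\<^esub> u" "inv\<^bsub>P\<^esub> v" v] P.l_inv[of v] P.inv_closed[of v]
        P.r_one[of "u \<otimes>\<^bsub>P\<^esub> u"] uv BC by (simp add: mult_P_closed)
    then have "half k ?w \<otimes>\<^bsub>P\<^esub> x = half k (u \<otimes>\<^bsub>P\<^esub> u)"
      using uv BC w half_mult[of ?w v k] by simp
    then have "half k ?w \<star> x = half (Suc k) (u \<otimes>\<^bsub>P\<^esub> u)"
      using mult_halved[of "half k ?w" x] uv BC w half_closed by simp
    then have "half k ?w \<star> x = y \<star> x" using uv BC half_double by simp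
    then have "half k ?w = y"
      by (rule right_cancel) (use uv w BC half_closed div in auto)
    then show ?case using w by blast
  qed
qed

end


section \<open>Free medial commutative quandles\<close>

lemma midpoint_dyadic_simps:
  "carrier (midpoint_quandle (dyadic_power m)) = {..<m} \<rightarrow>\<^sub>E dyadics"
  "x \<star>\<^bsub>midpoint_quandle (dyadic_power m)\<^esub> y = (\<lambda>i\<in>{..<m}. (x i + y i) / 2)"
  by (auto simp: midpoint_quandle_def dyadic_power_def fun_eq_iff)

lemma half_dyadic: "x \<in> dyadics \<Longrightarrow> x / 2 \<in> dyadics"
  using dyadics_closed(2)[of x "1/2"] dyadicsI[of "1/2" 1 1] by simp

lemma medial_commutative_quandle_midpoint_dyadic_power:
  "medial_commutative_quandle (midpoint_quandle (dyadic_power m))"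
proof (rule medial_commutative_quandleI, rule commutative_quandleI; (unfold midpoint_dyadic_simps)?)
  fix x y :: "nat \<Rightarrow> rat" assume "x \<in> {..<m} \<rightarrow>\<^sub>E dyadics" "y \<in> {..<m} \<rightarrow>\<^sub>E dyadics"
  then show "(\<lambda>i\<in>{..<m}. (x i + y i) / 2) \<in> {..<m} \<rightarrow>\<^sub>E dyadics"
    by (auto simp: PiE_iff intro!: half_dyadic dyadics_closed(1))
next
  fix x z :: "nat \<Rightarrow> rat" assume xz: "x \<in> {..<m} \<rightarrow>\<^sub>E dyadics" "z \<in> {..<m} \<rightarrow>\<^sub>E dyadics"
  have "2 * x i - z i \<in> dyadics" if "i < m" for i
  proof -
    have i: "x i \<in> dyadics" "z i \<in> dyadics" using xz that by (auto simp: PiE_iff)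
    have "(x i + x i) + - z i \<in> dyadics"
      by (intro dyadics_closed(1)) (rule i dyadics_closed(3)[OF i(2) i(2)])+
    then show ?thesis by simp
  qed
  then show "\<exists>y\<in>{..<m} \<rightarrow>\<^sub>E dyadics. (\<lambda>i\<in>{..<m}. (y i + z i) / 2) = x"
    using xz by (intro bexI[of _ "\<lambda>i\<in>{..<m}. 2 * x i - z i"])
      (auto simp: PiE_iff extensional_def fun_eq_iff)
next
  fix x y z :: "nat \<Rightarrow> rat"
  assume xy: "x \<in> {..<m} \<rightarrow>\<^sub>E dyadics" "y \<in> {..<m} \<rightarrow>\<^sub>E dyadics"
    and eq: "(\<lambda>i\<in>{..<m}. (x i + z i) / 2) = (\<lambda>i\<in>{..<m}. (y i + z i) / 2)"
  show "x = y"
  proof (rule PiE_ext[OF xy])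
    fix i assume "i \<in> {..<m}"
    then show "x i = y i" using fun_cong[OF eq, of i] by simp
  qed
next
  fix x :: "nat \<Rightarrow> rat" assume "x \<in> {..<m} \<rightarrow>\<^sub>E dyadics"
  then show "(\<lambda>i\<in>{..<m}. (x i + x i) / 2) = x"
    by (auto simp: PiE_iff extensional_def fun_eq_iff)
qed (simp_all add: fun_eq_iff field_simps)

lemma countable_carrier_midpoint_dyadic_power:
  "countable (carrier (midpoint_quandle (dyadic_power m)))"
proof (rule countable_subset)
  let ?r = "\<lambda>xs :: rat list. \<lambda>i\<in>{..<m}. xs ! i"
  show "carrier (midpoint_quandle (dyadic_power m)) \<subseteq> range ?r"
  proof
    fix v assume "v \<in> carrier (midpoint_quandle (dyadic_power m))"
    then have "v = ?r (map v [0..<m])"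
      by (auto simp: midpoint_dyadic_simps PiE_iff extensional_def fun_eq_iff)
    then show "v \<in> range ?r" by blast
  qed
qed simp

lemma common_denominator:
  fixes m :: nat
  assumes "\<And>i. i < m \<Longrightarrow> v i \<in> dyadics"
  shows "\<exists>k c. \<forall>i<m. v i = of_int (c i) / 2 ^ k"
  using assms
proof (induction m)
  case (Suc m)
  then obtain k c where kc: "\<forall>i<m. v i = of_int (c i) / 2 ^ k" by auto
  obtain a l where al: "v m = of_int a / 2 ^ l" using Suc.prems[of m] by (auto simp: dyadics_def)
  have "\<forall>i<Suc m. v i = of_int (if i = m then a * 2 ^ k else c i * 2 ^ l) / 2 ^ (k + l)"
    using kc al by (auto simp: power_add less_Suc_eq)
  then show ?case
    by (intro exI[of _ "k + l"] exI[of _ "\<lambda>i. if i = m then a * 2 ^ k else c i * 2 ^ l"])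
qed simp

text \<open>
  Freeness with respect to quandles on \<open>nat\<close> covers every countable target, by passing to a copy.
\<close>

lemma hom_into_countable:
  fixes Q :: "'q magma"
  assumes G: "free_medial_commutative_quandle TYPE(nat) X G \<kappa>"
    and Q: "medial_commutative_quandle Q" "countable (carrier Q)" and f: "f \<in> X \<rightarrow> carrier Q"
  obtains h where "h \<in> magma_hom G Q" "\<And>x. x \<in> X \<Longrightarrow> h (\<kappa> x) = f x"
proof -
  obtain N :: "nat magma" and d where N: "medial_commutative_quandle N"
      "to_nat_on (carrier Q) \<in> carrier Q \<rightarrow> carrier N"
      "d \<in> magma_hom N Q" "\<And>x. x \<in> carrier Q \<Longrightarrow> d (to_nat_on (carrier Q) x) = x"
    using medial_commutative_quandle_copy[OF Q(1) inj_on_to_nat_on[OF Q(2)]] by metis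
  have "(\<lambda>x. to_nat_on (carrier Q) (f x)) \<in> X \<rightarrow> carrier N" using f N(2) by auto
  then obtain h where h: "h \<in> magma_hom G N" "\<forall>x\<in>X. h (\<kappa> x) = to_nat_on (carrier Q) (f x)"
    using G N(1) unfolding free_medial_commutative_quandle_def unique_extensions_def by blast
  show ?thesis
  proof (rule that[of "\<lambda>x. d (h x)"])
    show "(\<lambda>x. d (h x)) \<in> magma_hom G Q"
      using h(1) N(3) by (auto simp: magma_hom_def Pi_iff)
  qed (use h f N(4) in auto)
qed

text \<open>
  One generator \<open>x\<^sub>0\<close> becomes the origin, and the other \<open>m\<close> generators become the unit vectors.
\<close>

theorem free_medial_isomorphic_dyadic_power:
  assumes X: "card X = Suc m"
    and G: "free_medial_commutative_quandle TYPE('g) X (G :: 'g magma) \<kappa>"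
      "free_medial_commutative_quandle TYPE(nat) X G \<kappa>"
  shows "magma_isomorphic G (midpoint_quandle (dyadic_power m))"
proof -
  let ?D = "midpoint_quandle (dyadic_power m)"
  have \<kappa>: "\<kappa> \<in> X \<rightarrow> carrier G"
    using G by (simp add: free_medial_commutative_quandle_def)
  obtain x\<^sub>0 where x\<^sub>0: "x\<^sub>0 \<in> X" using X by fastforce
  have "finite X" using X by (metis card.infinite nat.distinct(1))
  then obtain g where g: "bij_betw g {..<m} (X - {x\<^sub>0})"
    using ex_bij_betw_nat_finite[of "X - {x\<^sub>0}"] X x\<^sub>0 by (auto simp: atLeast0LessThan)
  have gX: "g i \<in> X" "g i \<noteq> x\<^sub>0" if "i < m" for i
    using g that by (auto simp: bij_betw_def)
  define e where "e = \<kappa> x\<^sub>0"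
  interpret medial_commutative_quandle G
    using G by (simp add: free_medial_commutative_quandle_def)
  interpret pointed_medial_quandle G e
    by unfold_locales (use \<kappa> x\<^sub>0 in \<open>auto simp: e_def\<close>)
  define a where "a i = \<kappa> (g i)" for i
  have a: "a i \<in> carrier G" if "i < m" for i using \<kappa> gX that by (auto simp: a_def)

  have gen: "carrier G = quandle_span G (\<kappa> ` X)"
    using G(1) medial_commutative_quandle_span[OF medial_commutative_quandle_axioms]
    by (intro carrier_eq_span_if_unique_extensions)
      (auto simp: free_medial_commutative_quandle_def quandle_axioms medial_commutative_quandle_axioms)

  \<comment> \<open>As \<open>x\<^sub>0\<close> is not of the form \<open>g i\<close>, it is sent to the zero vector.\<close>
  define f where "f x = (\<lambda>i\<in>{..<m}. if x = g i then 1 else 0 :: rat)" for x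
  have "f \<in> X \<rightarrow> carrier ?D"
    by (auto simp: f_def midpoint_dyadic_simps zero_one_dyadics)
  then obtain h where h: "h \<in> magma_hom G ?D" "\<And>x. x \<in> X \<Longrightarrow> h (\<kappa> x) = f x"
    using hom_into_countable[OF G(2) medial_commutative_quandle_midpoint_dyadic_power
        countable_carrier_midpoint_dyadic_power] by metis
  have hD: "h x \<in> {..<m} \<rightarrow>\<^sub>E dyadics" if "x \<in> carrier G" for x
    using h(1) that by (auto simp: magma_hom_def midpoint_dyadic_simps Pi_iff)
  have h_e: "h e l = 0" if "l < m" for l
    using h(2)[OF x\<^sub>0] that gX(2) by (auto simp: e_def f_def)
  have h_a: "h (a i) l = (if i = l then 1 else 0)" if "i < m" "l < m" for i l
    using h(2)[OF gX(1)] that g by (auto simp: a_def f_def bij_betw_def inj_on_def)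
  have h_star: "h (x \<star>\<^bsub>G\<^esub> y) l = (h x l + h y l) / 2" if "x \<in> carrier G" "y \<in> carrier G" "l < m" for x y l
    using h(1) that by (simp add: magma_hom_def midpoint_dyadic_simps)
  have h_mult: "h (x \<otimes>\<^bsub>P\<^esub> y) l = h x l + h y l"
    if xy: "x \<in> carrier G" "y \<in> carrier G" and l: "l < m" for x y l
  proof -
    have "h ((x \<otimes>\<^bsub>P\<^esub> y) \<star>\<^bsub>G\<^esub> e) l = h (x \<star>\<^bsub>G\<^esub> y) l" by (simp only: mult_halved xy)
    then show ?thesis unfolding h_star[OF mult_P_closed[OF xy] e l] h_star[OF xy l] h_e[OF l] by simp
  qed
  have inv_closed: "inv\<^bsub>P\<^esub> x \<in> carrier G" if "x \<in> carrier G" for x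
    using P.inv_closed[of x] that by simp
  have h_inv: "h (inv\<^bsub>P\<^esub> x) l = - h x l" if x: "x \<in> carrier G" and l: "l < m" for x l
  proof -
    have "inv\<^bsub>P\<^esub> x \<otimes>\<^bsub>P\<^esub> x = e" using P.l_inv[of x] x by (simp add: one_P)
    then show ?thesis using h_mult[OF inv_closed[OF x] x l] h_e[OF l] by simp
  qed
  have h_half: "h (half k x) l = h x l / 2 ^ k" if x: "x \<in> carrier G" and l: "l < m" for k x l
  proof (induction k)
    case (Suc k)
    then show ?case by (simp add: h_star[OF half_closed[OF x] e l] h_e[OF l])
  qed simp
  have npow_closed: "x [^]\<^bsub>P\<^esub> n \<in> carrier G" if "x \<in> carrier G" for x and n :: nat
    using P.nat_pow_closed[of x n] that by simp
  have h_npow: "h (x [^]\<^bsub>P\<^esub> n) l = of_nat n * h x l"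
    if x: "x \<in> carrier G" and l: "l < m" for x l and n :: nat
  proof (induction n)
    case 0 show ?case by (simp add: one_P h_e[OF l])
  next
    case (Suc n)
    then show ?case by (simp add: h_mult[OF npow_closed[OF x] x l] algebra_simps)
  qed
  have h_pow: "h (x [^]\<^bsub>P\<^esub> c) l = of_int c * h x l"
    if x: "x \<in> carrier G" and l: "l < m" for x l and c :: int
  proof (cases c rule: int_cases2)
    case (nonneg n)
    then show ?thesis by (simp add: int_pow_int h_npow[OF x l])
  next
    case (nonpos n)
    then have "x [^]\<^bsub>P\<^esub> c = inv\<^bsub>P\<^esub> (x [^]\<^bsub>P\<^esub> n)" using P.int_pow_neg_int[of x n] x by simp
    then show ?thesis
      using nonpos by (simp add: h_inv[OF npow_closed[OF x] l] h_npow[OF x l])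
  qed

  \<comment> \<open>Additively, \<open>L c\<close> is the integer combination \<open>\<Sum> c i * a i\<close>; \<open>h\<close> recovers \<open>c\<close> from it.\<close>
  define L where "L c = finprod P (\<lambda>i. a i [^]\<^bsub>P\<^esub> (c i :: int)) {..<m}" for c
  have pow_closed: "(\<lambda>i. a i [^]\<^bsub>P\<^esub> (c i :: int)) \<in> I \<rightarrow> carrier P" if "I \<subseteq> {..<m}" for c I
    using a that P.int_pow_closed by fastforce
  have LC: "L c \<in> carrier G" for c
    using P.finprod_closed[OF pow_closed] by (simp add: L_def)
  have h_L: "h (L c) l = of_int (c l)" if l: "l < m" for c l
  proof -
    have "h (finprod P (\<lambda>i. a i [^]\<^bsub>P\<^esub> (c i :: int)) I) l = (\<Sum>i\<in>I. of_int (c i) * h (a i) l)"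
      if "finite I" "I \<subseteq> {..<m}" for I
      using that
    proof (induction I)
      case empty then show ?case using l by (simp add: h_e one_P)
    next
      case (insert i I)
      have "finprod P (\<lambda>i. a i [^]\<^bsub>P\<^esub> (c i :: int)) I \<in> carrier G"
        using P.finprod_closed[OF pow_closed] insert.prems by simp
      moreover have "a i [^]\<^bsub>P\<^esub> c i \<in> carrier G"
        using P.int_pow_closed[of "a i"] a insert.prems by simp
      ultimately show ?case using insert pow_closed[of I] l a
        by (simp add: P.finprod_insert h_mult h_pow)
    qed
    then show ?thesis using l by (simp add: L_def h_a if_distrib sum.delta cong: if_cong)
  qed
  have L_mult: "L c \<otimes>\<^bsub>P\<^esub> L d = L (\<lambda>i. c i + d i)" for c d
  proof -
    have "L (\<lambda>i. c i + d i) = finprod P (\<lambda>i. a i [^]\<^bsub>P\<^esub> c i \<otimes>\<^bsub>P\<^esub> a i [^]\<^bsub>P\<^esub> d i) {..<m}"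
      unfolding L_def
    proof (rule P.finprod_cong')
      show "(\<lambda>i. a i [^]\<^bsub>P\<^esub> c i \<otimes>\<^bsub>P\<^esub> a i [^]\<^bsub>P\<^esub> d i) \<in> {..<m} \<rightarrow> carrier P"
        using pow_closed[of "{..<m}" c] pow_closed[of "{..<m}" d] P.m_closed by (simp add: Pi_iff)
      fix i assume "i \<in> {..<m}"
      then show "a i [^]\<^bsub>P\<^esub> (c i + d i) = a i [^]\<^bsub>P\<^esub> c i \<otimes>\<^bsub>P\<^esub> a i [^]\<^bsub>P\<^esub> d i"
        using a P.int_pow_mult[of "a i"] by simp
    qed simp
    then show ?thesis
      unfolding L_def using P.finprod_multf[OF pow_closed pow_closed, of "{..<m}" c d] by simp
  qed
  have L_0: "L (\<lambda>i. 0) = e"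
    unfolding L_def by (subst one_P[symmetric]) simp
  have L_delta: "L (\<lambda>i. if i = j then 1 else 0) = a j" if "j < m" for j
  proof -
    have "L (\<lambda>i. if i = j then 1 else 0) = finprod P (\<lambda>i. if j = i then a i else \<one>\<^bsub>P\<^esub>) {..<m}"
      unfolding L_def by (rule P.finprod_cong') (use a e one_P in auto)
    also have "\<dots> = a j" by (rule P.finprod_singleton) (use that a in auto)
    finally show ?thesis .
  qed
  have "subgroup (range L) P"
  proof (rule P.subgroupI)
    fix u assume "u \<in> range L"
    then obtain c where c: "u = L c" by blast
    have "L (\<lambda>i. - c i) \<otimes>\<^bsub>P\<^esub> u = \<one>\<^bsub>P\<^esub>" by (simp add: c L_mult L_0 one_P)
    then have "inv\<^bsub>P\<^esub> u = L (\<lambda>i. - c i)" using LC c by (simp add: P.inv_equality)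
    then show "inv\<^bsub>P\<^esub> u \<in> range L" by blast
  qed (use LC L_mult in auto)
  moreover have "\<kappa> x \<in> range L" if "x \<in> X" for x
  proof (cases "x = x\<^sub>0")
    case True then show ?thesis using L_0 by (metis e_def rangeI)
  next
    case False
    then have "x \<in> g ` {..<m}" using that bij_betw_imp_surj_on[OF g] by simp
    then obtain j where "j < m" "x = g j" by auto
    then show ?thesis using L_delta by (metis a_def rangeI)
  qed
  ultimately have repr: "\<exists>k c. x = half k (L c)" if "x \<in> carrier G" for x
    using span_eq_halved_subgroup[of "range L" "\<kappa> ` X" x] that gen by blast

  \<comment> \<open>\<open>h\<close> is additive, so injectivity reduces to a trivial kernel.\<close>
  have kernel: "x = e" if x: "x \<in> carrier G" and 0: "\<And>l. l < m \<Longrightarrow> h x l = 0" for x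
  proof -
    obtain k c where kc: "x = half k (L c)" using repr x by blast
    have "c l = 0" if "l < m" for l
      using 0[OF that] h_half[OF LC that] h_L[OF that] by (simp add: kc)
    then have "L c = L (\<lambda>i. 0)"
      unfolding L_def by (intro P.finprod_cong') (use a e one_P in auto)
    then have "x = half k e" by (simp add: kc L_0)
    also have "\<dots> = e" by (induction k) (use e star_idem in auto)
    finally show ?thesis .
  qed
  have "inj_on h (carrier G)"
  proof (rule inj_onI)
    fix x y assume xy: "x \<in> carrier G" "y \<in> carrier G" "h x = h y"
    have y': "inv\<^bsub>P\<^esub> y \<in> carrier G" using P.inv_closed[of y] xy by simp
    have "x \<otimes>\<^bsub>P\<^esub> inv\<^bsub>P\<^esub> y = e"
      by (rule kernel) (use xy y' in \<open>auto simp: mult_P_closed h_mult h_inv\<close>)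
    then have "inv\<^bsub>P\<^esub> (inv\<^bsub>P\<^esub> y) = x" using xy y' by (intro P.inv_equality) (auto simp: one_P)
    then show "x = y" using xy by simp
  qed
  moreover have "h ` carrier G = carrier ?D"
  proof (intro equalityI subsetI)
    fix v assume v: "v \<in> carrier ?D"
    then have "\<exists>k c. \<forall>i<m. v i = of_int (c i) / 2 ^ k"
      by (intro common_denominator) (auto simp: midpoint_dyadic_simps)
    then obtain k c where kc: "\<forall>i<m. v i = of_int (c i) / 2 ^ k" by blast
    have "h (half k (L c)) = v"
      using v hD[OF half_closed[OF LC]] kc
      by (intro PiE_ext[of _ "{..<m}" "\<lambda>_. dyadics"]) (auto simp: midpoint_dyadic_simps h_half LC h_L)
    then show "v \<in> h ` carrier G" using half_closed[OF LC] by blast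
  qed (use hD in \<open>auto simp: midpoint_dyadic_simps\<close>)
  ultimately have "h \<in> magma_iso G ?D"
    using h(1) by (simp add: magma_iso_def bij_betw_def)
  then show ?thesis by (auto simp: magma_isomorphic_def)
qed


section \<open>Free commutative quandles on at most three generators\<close>

lemma free_commutative_is_free_medial:
  assumes X: "finite X" "card X \<le> 3"
    and F: "free_commutative_quandle TYPE('f) X (F :: 'f magma) \<iota>"
      "free_commutative_quandle TYPE('q) X F \<iota>"
  shows "free_medial_commutative_quandle TYPE('q) X F \<iota>"
proof -
  interpret commutative_quandle F
    using F by (simp add: free_commutative_quandle_def)
  have "carrier F = quandle_span F (\<iota> ` X)"
    using F(1) commutative_quandle_span[OF commutative_quandle_axioms]
    by (intro carrier_eq_span_if_unique_extensions)
      (auto simp: free_commutative_quandle_def quandle_axioms)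
  moreover have "card (\<iota> ` X) \<le> 3" using X card_image_le[of X \<iota>] by simp
  ultimately have "medial_commutative_quandle F"
    using X by (intro medial_if_three_generators) auto
  then show ?thesis
    using F(2) medial_commutative_quandle.axioms(1)
    by (auto simp: free_commutative_quandle_def free_medial_commutative_quandle_def)
qed

lemma magma_isomorphic_if_common_target:
  assumes "magma A" "magma B" "magma_isomorphic A C" "magma_isomorphic B C"
  shows "magma_isomorphic A B"
proof -
  interpret A: magma A by fact
  interpret B: magma B by fact
  obtain f g where f: "f \<in> magma_hom A C" "bij_betw f (carrier A) (carrier C)"
    and g: "g \<in> magma_hom B C" "bij_betw g (carrier B) (carrier C)"
    using assms by (auto simp: magma_isomorphic_def magma_iso_def)
  let ?g' = "inv_into (carrier B) g"
  have bij: "bij_betw (\<lambda>x. ?g' (f x)) (carrier A) (carrier B)"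
    using bij_betw_trans[OF f(2) bij_betw_inv_into[OF g(2)]] by (simp add: comp_def)
  have B: "?g' (f x) \<in> carrier B" if "x \<in> carrier A" for x
    using bij that by (auto simp: bij_betw_def)
  have g': "g (?g' (f x)) = f x" if "x \<in> carrier A" for x
    using g(2) f(1) that by (auto simp: magma_hom_def Pi_iff bij_betw_def f_inv_into_f)
  have "?g' (f (x \<star>\<^bsub>A\<^esub> y)) = ?g' (f x) \<star>\<^bsub>B\<^esub> ?g' (f y)" if xy: "x \<in> carrier A" "y \<in> carrier A" for x y
  proof -
    have "g (?g' (f (x \<star>\<^bsub>A\<^esub> y))) = g (?g' (f x) \<star>\<^bsub>B\<^esub> ?g' (f y))"
      using xy f(1) g(1) g'[OF A.star_closed[OF xy]] g' B by (simp add: magma_hom_def)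
    moreover have "?g' (f x) \<star>\<^bsub>B\<^esub> ?g' (f y) \<in> carrier B"
      using xy B B.star_closed by simp
    ultimately show ?thesis
      using xy B A.star_closed g(2) by (auto simp: bij_betw_def dest: inj_onD)
  qed
  then have "(\<lambda>x. ?g' (f x)) \<in> magma_iso A B"
    using bij B by (auto simp: magma_iso_def magma_hom_def)
  then show ?thesis by (auto simp: magma_isomorphic_def)
qed

theorem corollary6p2:
  fixes X :: "'x set" and n :: nat
    and F :: "'f magma" and \<iota> :: "'x \<Rightarrow> 'f"
    and G :: "'g magma" and \<kappa> :: "'x \<Rightarrow> 'g"
  assumes "card X = n" and "1 \<le> n" and "n \<le> 3"
    and "free_commutative_quandle TYPE('f) X F \<iota>"
    and "free_commutative_quandle TYPE(nat) X F \<iota>"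
    and "free_medial_commutative_quandle TYPE('g) X G \<kappa>"
    and "free_medial_commutative_quandle TYPE(nat) X G \<kappa>"
  shows "magma_isomorphic F G \<and>
         magma_isomorphic G (midpoint_quandle (dyadic_power (n - 1)))"
proof -
  have X: "card X = Suc (n - 1)" "finite X" "card X \<le> 3"
    using assms(1-3) card.infinite[of X] by auto
  have G: "magma_isomorphic G (midpoint_quandle (dyadic_power (n - 1)))"
    by (rule free_medial_isomorphic_dyadic_power[OF X(1) assms(6,7)])
  have "magma_isomorphic F (midpoint_quandle (dyadic_power (n - 1)))"
    by (rule free_medial_isomorphic_dyadic_power[OF X(1)])
      (rule free_commutative_is_free_medial[OF X(2,3) assms(4)], rule assms)+
  moreover have "magma F" "magma G"
    using assms(4,6) by (simp_all add: free_commutative_quandle_def commutative_quandle_def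
        free_medial_commutative_quandle_def medial_commutative_quandle_def quandle_def rack_def)
  ultimately show ?thesis using magma_isomorphic_if_common_target G by blast
qed

end
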